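(* For any integers $k\ge 2$ and $r\ge 2$, there exists a tree $T$ with $\rho(T)=\sqrt{k}$ and $\Delta(T)=r$ if and only if $\frac14 k+1<r\le k$.
   Context: $\rho(T)$ is the spectral radius (largest adjacency eigenvalue) of $T$ and $\Delta(T)$ its maximum degree. *)

theory Defs
  imports "Graph_Theory.Graph_Theory" "Jordan_Normal_Form.Spectral_Radius"
begin

text \<open>
  A finite simple graph is a loop-free symmetric digraph without parallel arcs
  (locale \<^locale>\<open>pair_graph\<close>), each undirected edge being the two opposite arcs.  The constant
  \<^const>\<open>Digraph_Component.tree\<close> cannot be used for such graphs: it forbids all directed cycles,
  hence also the closed walk \<open>u, v, u\<close> along a single undirected edge.  The cycles of the
  undirected graph are exactly the directed cycles of length at least three.  The null graph
  is not \<^const>\<open>Digraph_Component.connected\<close>, so trees are nonempty.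
\<close>

definition undirected_tree :: "'a pair_pre_digraph \<Rightarrow> bool" where
  "undirected_tree T \<longleftrightarrow>
     pair_graph T \<and>
     Digraph_Component.connected (with_proj T) \<and>
     \<not> (\<exists>p. pre_digraph.cycle (with_proj T) p \<and> 3 \<le> length p)"

text \<open>Rows and columns are indexed by the vertices in increasing order.\<close>

definition adjacency_matrix :: "'a :: linorder pair_pre_digraph \<Rightarrow> real mat" where
  "adjacency_matrix T =
     (let vs = sorted_list_of_set (pverts T) in
      mat (length vs) (length vs) (\<lambda>(i, j). if (vs ! i, vs ! j) \<in> parcs T then 1 else 0))"

text \<open>
  The adjacency matrix is real symmetric, so its real spectrum is its full spectrum, and it is
  finite and nonempty whenever the graph is.
\<close>

definition graph_spectral_radius :: "'a :: linorder pair_pre_digraph \<Rightarrow> real" where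
  "graph_spectral_radius T = Max (spectrum (adjacency_matrix T))"

text \<open>In a symmetric digraph the out-degree is the number of neighbours.\<close>

definition max_degree :: "'a pair_pre_digraph \<Rightarrow> nat" where
  "max_degree T = Max (out_degree (with_proj T) ` pverts T)"

end

theory Submission
  imports Defs "HOL-Analysis.Function_Topology"
begin

text \<open>
  Necessity: the star at a vertex of degree \<open>r\<close> gives \<open>\<rho> \<ge> sqrt r\<close> by the Rayleigh principle, and a
  positive function that is a strict supersolution for \<open>2 sqrt (r - 1)\<close> on the tree, rooted
  anywhere, gives \<open>\<rho> < 2 sqrt (r - 1)\<close>.

  Sufficiency: a positive eigenfunction \<open>x\<close> has eigenvalue \<open>\<rho>\<close>. For \<open>\<rho> = sqrt k\<close> on a rooted tree, label
  each vertex \<open>v\<close> with parent \<open>p\<close> by \<open>t = sqrt k * x v / x p\<close>. The eigenvalue equation at \<open>v\<close> reads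
  \<open>t = k / (k - s)\<close>, where \<open>s\<close> is the sum of the labels of the children of \<open>v\<close> (so a leaf has label
  \<open>1\<close>), and at the root it says that the labels of the children sum to \<open>k\<close>. With
  \<open>D = k div 4 + 1 < r\<close> children per vertex one reaches the labels \<open>2 - 1 / n\<close> one after the
  other, then \<open>2\<close>, then larger labels up to \<open>D + 1\<close>; finally \<open>r\<close> labels from \<open>{1, 2, D + 1}\<close>
  are chosen with sum \<open>k\<close>.
\<close>

section \<open>Labels of rooted branches\<close>

text \<open>
  \<open>branch D k m s\<close> stands for a rooted tree whose root has \<open>m\<close> children, with labels summing to \<open>s\<close>,
  and whose other vertices have at most \<open>D\<close> children each.
\<close>

inductive branch :: "nat \<Rightarrow> nat \<Rightarrow> nat \<Rightarrow> real \<Rightarrow> bool" for D k where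
  single: "branch D k 0 0"
| attach: "branch D k m s \<Longrightarrow> branch D k m' s' \<Longrightarrow> m' \<le> D \<Longrightarrow> s' < real k \<Longrightarrow>
    branch D k (Suc m) (s + real k / (real k - s'))"

lemma branch_mono: "branch D k m s \<Longrightarrow> D \<le> D' \<Longrightarrow> branch D' k m s"
  by (induction rule: branch.induct) (auto intro: branch.intros)

definition label :: "nat \<Rightarrow> nat \<Rightarrow> real \<Rightarrow> bool" where
  "label D k t \<longleftrightarrow> (\<exists>m s. branch D k m s \<and> m \<le> D \<and> s < real k \<and> t = real k / (real k - s))"

lemma branch_labels:
  assumes "\<And>t. t \<in> set ts \<Longrightarrow> label D k t"
  shows "branch D k (length ts) (sum_list ts)"
  using assms
proof (induction ts)
  case Nil
  show ?case by (simp add: branch.single)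
next
  case (Cons t ts)
  have "label D k t" using Cons.prems by simp
  then obtain m s where "branch D k m s" "m \<le> D" "s < real k" "t = real k / (real k - s)"
    unfolding label_def by blast
  with branch.attach[OF Cons.IH this(1-3)] Cons.prems show ?case
    by (simp add: add.commute)
qed

lemma labelI:
  assumes "\<And>t. t \<in> set ts \<Longrightarrow> label D k t" "length ts \<le> D" "sum_list ts < real k"
    "u = real k / (real k - sum_list ts)"
  shows "label D k u"
  using branch_labels[OF assms(1)] assms(2-4) unfolding label_def by blast

lemma label_one: "k > 0 \<Longrightarrow> label D k 1"
  by (rule labelI[of "[]"]) auto

text \<open>Expresses an integer with as few labels \<open>1\<close> and \<open>2\<close> as
  possible, because the number of children is capped.\<close>

lemma sum_list_ones_twos: "sum_list (replicate (q div 2) 2 @ replicate (q mod 2) (1::real)) = real q"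
proof -
  have "real q = real (2 * (q div 2) + q mod 2)" by simp
  then show ?thesis unfolding of_nat_add of_nat_mult by (simp add: sum_list_replicate)
qed

text \<open>
  With \<open>k = 4 D - c\<close>, a vertex with \<open>D\<close> children labelled \<open>t\<close> has a label exceeding \<open>t\<close> for every
  admissible \<open>t\<close>, but near \<open>t = 2\<close> only barely so. For \<open>c = 0\<close> the labels of the complete
  \<open>D\<close>-ary trees would be \<open>2 n / (n + 1)\<close> and never pass \<open>2\<close>.
\<close>

locale bottleneck =
  fixes D k c :: nat
  assumes k: "k + c = 4 * D" and k2: "k \<ge> 2" and c1: "c \<ge> 1" and c4: "c \<le> 4"
begin

lemma real_k: "real k = 4 * real D - real c"
  using k by linarith

lemma D_pos: "D \<ge> 1" using k k2 by linarith

text \<open>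
  Two generations: \<open>D\<close> copies of the branch with children \<open>ts\<close> are joined under a new root.
  Taking \<open>X = - c - D / n\<close>, \<open>X = - c\<close> and \<open>X = D - 1 - c\<close> yields the labels \<open>2 - 1 / (n + 1)\<close>,
  \<open>2\<close> and \<open>D + 1\<close>.
\<close>

lemma label_two_step:
  assumes ts: "\<And>t. t \<in> set ts \<Longrightarrow> label D k t" and len: "length ts \<le> D"
    and sum: "sum_list ts = 2 * real D + X" and X: "real c + X < real D"
    and u: "u = (2 * real D - real c - X) / (real D - real c - X)"
  shows "label D k u"
proof -
  have D0: "real D \<ge> 1" using D_pos by simp
  have k0: "real k > 0" using k2 by simp
  let ?w = "2 * real D - real c - X"
  have w: "?w > 0" using X D0 by simp
  have l: "label D k (real k / ?w)"
    by (rule labelI[OF ts len]) (use sum X D0 real_k in \<open>auto\<close>)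
  \<comment> \<open>The \<open>D\<close> equal children leave \<open>k * (?w - D) / ?w\<close> of
    \<open>k\<close>, so the second label is \<open>?w / (?w - D)\<close>; assumption
    \<open>X\<close> makes \<open>?w - D\<close> positive.\<close>
  have eq: "real k - real D * (real k / ?w) = real k * (real D - real c - X) / ?w"
    using w by (simp add: field_simps)
  have pos: "real k * (real D - real c - X) / ?w > 0"
    using w X k0 by (intro divide_pos_pos mult_pos_pos) auto
  show ?thesis
  proof (rule labelI[of "replicate D (real k / ?w)"])
    show "sum_list (replicate D (real k / ?w)) < real k"
      using eq pos by (simp add: sum_list_replicate)
    show "u = real k / (real k - sum_list (replicate D (real k / ?w)))"
      unfolding sum_list_replicate eq u using k0 w X by simp
  qed (use l in auto)
qed

text \<open>Supplies the children for \<open>X = - c - D / n\<close> in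
  \<open>label_two_step\<close>. The key is that \<open>j\<close> copies of \<open>2 - 1 / j\<close>
  sum to the integer \<open>2 * j - 1\<close>: a group of size \<open>n - c\<close> and
  \<open>c\<close> leaves replace \<open>n\<close> of the \<open>D\<close> copies of
  \<open>2 - 1 / n\<close>. For small \<open>n\<close> leaves alone replace the group.\<close>

lemma deficit_list:
  assumes n: "1 \<le> n" "n + c \<le> D"
  shows "\<exists>ts. set ts \<subseteq> (\<lambda>j. 2 - 1 / real j) ` {1..n} \<and> length ts \<le> D \<and>
    sum_list ts = 2 * real D - real c - real D / real n"
proof -
  let ?u = "\<lambda>j::nat. 2 - 1 / real j"
  \<comment> \<open>Since \<open>c \<le> 4\<close>, the only pair with \<open>1 < n \<le> c\<close>
    and \<open>2 * n \<le> c\<close> is \<open>c = 4\<close>, \<open>n = 2\<close>; there the leaf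
    count \<open>2 * n - c - 1\<close> of the third case would be negative.\<close>
  consider "n = 1" | "n > c" | "n > 1" "n \<le> c" "c + 1 \<le> 2 * n" | "c = 4" "n = 2"
    using c4 n by linarith
  then show ?thesis
  proof cases
    case 1
    then show ?thesis using n
      by (intro exI[of _ "replicate (D - c) (?u 1)"]) (auto simp: sum_list_replicate of_nat_diff)
  next
    case 2
    let ?ts = "replicate c (?u 1) @ replicate (n - c) (?u (n - c)) @ replicate (D - n) (?u n)"
    have "real (n - c) * ?u (n - c) = 2 * (real n - real c) - 1"
      using 2 by (simp add: right_diff_distrib of_nat_diff)
    moreover have "real (D - n) * ?u n = 2 * (real D - real n) - real D / real n + 1"
      using 2 n by (simp add: field_simps of_nat_diff)
    ultimately have "sum_list ?ts = 2 * real D - real c - real D / real n"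
      unfolding sum_list_append sum_list_replicate by (simp del: of_nat_diff)
    moreover have "length ?ts \<le> D" using 2 n by simp
    moreover have "set ?ts \<subseteq> ?u ` {1..n}"
    proof
      fix t assume "t \<in> set ?ts"
      then have "t \<in> ?u ` {1, n - c, n}" by auto
      then show "t \<in> ?u ` {1..n}" using 2 n c1 by (elim imageE) auto
    qed
    ultimately show ?thesis by blast
  next
    case 3
    then show ?thesis using n c1
      by (intro exI[of _ "replicate (2 * n - c - 1) (?u 1) @ replicate (D - n) (?u n)"])
         (auto simp: sum_list_replicate of_nat_diff field_simps)
  next
    case 4
    let ?ts = "replicate 2 (?u 1) @ replicate (D - 4) (?u n)"
    have "set ?ts \<subseteq> ?u ` {1..n}"
    proof
      fix t assume "t \<in> set ?ts"
      then have "t \<in> ?u ` {1, n}" by auto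
      then show "t \<in> ?u ` {1..n}" using n by (elim imageE) auto
    qed
    moreover have "length ?ts \<le> D" using 4 n by simp
    moreover have "sum_list ?ts = 2 * real D - real c - real D / real n"
      using 4 n by (simp add: sum_list_replicate of_nat_diff field_simps)
    ultimately show ?thesis by blast
  qed
qed

text \<open>Each label comes from the earlier ones by \<open>deficit_list\<close> at
  \<open>n - 1\<close>, which requires \<open>n - 1 + c \<le> D\<close>; this fixes the range. If
  \<open>c \<ge> D\<close>, truncated subtraction leaves only the leaf label.\<close>

lemma label_deficit: "1 \<le> n \<Longrightarrow> n \<le> D - c + 1 \<Longrightarrow> label D k (2 - 1 / real n)"
proof (induction n rule: less_induct)
  case (less n)
  show ?case
  proof (cases "n = 1")
    case True
    then show ?thesis using label_one[of k D] k2 by simp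
  next
    case False
    define m where "m = n - 1"
    have m: "n = Suc m" "1 \<le> m" "m + c \<le> D" using False less.prems unfolding m_def by auto
    from deficit_list[OF m(2,3)] obtain ts where ts: "set ts \<subseteq> (\<lambda>j. 2 - 1 / real j) ` {1..m}"
      "length ts \<le> D" "sum_list ts = 2 * real D - real c - real D / real m" by auto
    have D0: "real D > 0" using D_pos by simp
    show ?thesis
    proof (rule label_two_step[where ts = ts and X = "- real c - real D / real m"])
      show "label D k t" if "t \<in> set ts" for t
        using that ts(1) m less.IH less.prems by fastforce
      show "2 - 1 / real n = (2 * real D - real c - (- real c - real D / real m)) /
          (real D - real c - (- real c - real D / real m))"
      proof -
        have "real D + real D / real m > 0" using D0 by (simp add: add_pos_nonneg)
        then show ?thesis using m D0 by (simp add: divide_simps) (simp add: algebra_simps)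
      qed
      have "real D / real m \<ge> 0" by simp
      with D0 show "real c + (- real c - real D / real m) < real D" by linarith
    qed (use ts in auto)
  qed
qed

lemma label_two: "label D k 2"
proof -
  have D0: "real D > 0" using D_pos by simp
  have *: "label D k 2" if "\<And>t. t \<in> set ts \<Longrightarrow> label D k t" "length ts \<le> D"
    "sum_list ts = 2 * real D - real c" for ts
    by (rule label_two_step[where ts = ts and X = "- real c"]) (use that D0 in auto)
  show ?thesis
  proof (cases "c < D")
    case True
    \<comment> \<open>The last index that \<open>label_deficit\<close> offers. The group of
      \<open>?j\<close> labels sums to \<open>2 * ?j - 1\<close>, and \<open>c - 1\<close> leaves
      complete it to \<open>D\<close> children with sum \<open>2 * D - c\<close>.\<close>
    let ?j = "D - c + 1"
    have "label D k (2 - 1 / real ?j)" by (rule label_deficit) auto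
    moreover have "real ?j * (2 - 1 / real ?j) = 2 * real ?j - 1"
      by (simp add: field_simps)
    then have "sum_list (replicate (c - 1) 1 @ replicate ?j (2 - 1 / real ?j)) = 2 * real D - real c"
      unfolding sum_list_append sum_list_replicate using True c1 by (simp add: of_nat_diff)
    ultimately show ?thesis using True c1 label_one[of k D] k2
      by (intro *[of "replicate (c - 1) 1 @ replicate ?j (2 - 1 / real ?j)"]) auto
  next
    case False
    moreover have "c \<le> 2 * D" using k k2 c4 by presburger
    ultimately show ?thesis using k k2 label_one[of k D]
      by (intro *[of "replicate (2 * D - c) 1"]) (auto simp: sum_list_replicate of_nat_diff)
  qed
qed

text \<open>Past \<open>2\<close>, the surplus \<open>X\<close> over \<open>2 * D\<close> grows by
  one per step: \<open>D - c - X\<close> copies of the current label sum to an integer with surplus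
  \<open>c + X\<close> over twos, \<open>c - 1\<close> leaves lose \<open>c - 1\<close>, and twos
  fill up to \<open>D\<close> children.\<close>

lemma label_excess:
  "X + c < D \<Longrightarrow> label D k (2 + (real c + real X) / (real D - real c - real X))"
proof (induction X)
  case 0
  show ?case
    by (rule label_two_step[where ts = "replicate D 2" and X = 0])
       (use 0 label_two in \<open>auto simp: sum_list_replicate field_simps\<close>)
next
  case (Suc X)
  let ?q = "D - c - X"
  let ?y = "2 + (real c + real X) / (real D - real c - real X)"
  have q: "real ?q = real D - real c - real X" using Suc.prems by (simp add: of_nat_diff)
  have "real ?q > 0" using Suc.prems by simp
  then have "real ?q * ?y = 2 * real ?q + (real c + real X)"
    unfolding q by (simp add: field_simps)
  then have sum: "sum_list (replicate ?q ?y @ replicate (c - 1) 1 @ replicate (X + 1) 2)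
     = 2 * real D + real (Suc X)"
    using c1 Suc.prems unfolding sum_list_append sum_list_replicate
    by (simp add: of_nat_diff)
  let ?d = "real D - real c - real (Suc X)"
  have "?d > 0" using Suc.prems by linarith
  moreover have "2 + p / d = (2 * d + p) / d" if "d > 0" for p d :: real
    using that by (simp add: add_divide_distrib)
  ultimately have "2 + (real c + real (Suc X)) / ?d = (2 * ?d + (real c + real (Suc X))) / ?d"
    by blast
  also have "2 * ?d + (real c + real (Suc X)) = 2 * real D - real c - real (Suc X)"
    by (simp add: algebra_simps)
  finally have eq: "2 + (real c + real (Suc X)) / ?d = (2 * real D - real c - real (Suc X)) / ?d" .
  show ?case
    by (rule label_two_step[where ts = "replicate ?q ?y @ replicate (c - 1) 1 @ replicate (X + 1) 2"
          and X = "real (Suc X)", OF _ _ sum _ eq])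
       (use Suc.prems Suc.IH label_two label_one[of k D] k2 c1 in auto)
qed

lemma label_Suc_D: "label D k (real D + 1)"
proof (cases "c < D")
  case True
  then have "real D - real c - real (D - 1 - c) = 1" by (simp add: of_nat_diff)
  moreover have "real c + real (D - 1 - c) = real D - 1" using True by (simp add: of_nat_diff)
  ultimately show ?thesis using label_excess[of "D - 1 - c"] True by (simp add: add.commute)
next
  case False
  \<comment> \<open>For such small \<open>D\<close> the required sum
    \<open>2 * D + (D - 1 - c)\<close> is an integer below \<open>2 * D\<close>, so ones and twos
    suffice.\<close>
  let ?q = "3 * D - 1 - c"
  have ge: "3 * D \<ge> 1 + c"  using k k2 c4 False by linarith
  then have q: "real ?q = 2 * real D + (real D - 1 - real c)" by linarith
  show ?thesis
    by (rule label_two_step[where ts = "replicate (?q div 2) 2 @ replicate (?q mod 2) 1"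
          and X = "real D - 1 - real c"])
       (use False label_two label_one[of k D] k2 q in \<open>auto simp: sum_list_ones_twos simp del: sum_list_append\<close>)
qed

end

lemma branch_exists:
  assumes k2: "k \<ge> 2" and r: "real k / 4 + 1 < real r" "r \<le> k"
  shows "branch (r - 1) k r (real k)"
proof -
  \<comment> \<open>The least \<open>D\<close> with \<open>k < 4 * D\<close>; the lower bound on
    \<open>r\<close> then yields \<open>D \<le> r - 1\<close>.\<close>
  define D c where "D = k div 4 + 1" and "c = 4 - k mod 4"
  interpret bottleneck D k c
  proof
    show "k + c = 4 * D" unfolding D_def c_def by presburger
    show "1 \<le> c" "c \<le> 4" unfolding c_def using mod_less_divisor[of 4 k] by linarith+
  qed (fact k2)
  have "real k < 4 * real (r - 1)" "r \<ge> 1" using r by (auto simp: of_nat_diff)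
  then have D: "D + 1 \<le> r" unfolding D_def by linarith
  define x b where "x = (k - r) div D" and "b = (k - r) mod D"
  have xb: "k - r = x * D + b" "b < D" using D_pos unfolding x_def b_def by auto
  have "x * D < 3 * D" using xb k D c1 r by linarith
  then have "x \<le> 2" by simp
  \<comment> \<open>At most \<open>r\<close> children can be upgraded from leaves. For
    \<open>x \<le> 1\<close> this follows from \<open>b < D < r\<close>; for \<open>x = 2\<close>,
    \<open>k < 4 * D\<close> and \<open>D < r\<close> force \<open>b \<le> D - 2\<close>.\<close>
  have x2: "x + b \<le> r"
  proof (cases "x = 2")
    case True
    then show ?thesis using xb k D c1 r by linarith
  next
    case False
    then show ?thesis using \<open>x \<le> 2\<close> xb D by linarith
  qed
  \<comment> \<open>Starting from \<open>r\<close> leaves, replacing one by a label \<open>2\<close> or \<open>D + 1\<close> contributes \<open>1\<close> or \<open>D\<close> to the missing \<open>k - r\<close>.\<close>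
  let ?ts = "replicate x (real D + 1) @ replicate b 2 @ replicate (r - x - b) 1"
  have "branch D k (length ?ts) (sum_list ?ts)"
    by (rule branch_labels) (use label_Suc_D label_two label_one[of k D] k2 in auto)
  moreover have "length ?ts = r" using x2 by simp
  moreover have "sum_list ?ts = real k"
  proof -
    have "real k = real x * real D + real b + real r"
      using xb r by (metis le_add_diff_inverse2 of_nat_add of_nat_mult)
    then show ?thesis using x2 by (simp add: sum_list_replicate of_nat_diff algebra_simps)
  qed
  ultimately have "branch D k r (real k)" by simp
  then show ?thesis using D branch_mono by force
qed

section \<open>The spectral radius of a graph\<close>

text \<open>A maximiser of the quadratic form on the unit sphere exists by compactness, and it is an
  eigenfunction because it is a critical point.\<close>

lemma ex_max_eigenfunction:
  fixes a :: "'a \<Rightarrow> 'a \<Rightarrow> real"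
  assumes fin: "finite V" and ne: "V \<noteq> {}" and sym: "\<And>u v. u \<in> V \<Longrightarrow> v \<in> V \<Longrightarrow> a u v = a v u"
  obtains x \<mu> where "\<exists>v\<in>V. x v \<noteq> 0" "\<And>v. v \<in> V \<Longrightarrow> (\<Sum>u\<in>V. a v u * x u) = \<mu> * x v"
    "\<And>y. (\<Sum>v\<in>V. \<Sum>u\<in>V. a v u * y v * y u) \<le> \<mu> * (\<Sum>v\<in>V. (y v)\<^sup>2)"
proof -
  define Q where "Q y = (\<Sum>v\<in>V. \<Sum>u\<in>V. a v u * y v * y u)" for y
  define q where "q y = (\<Sum>v\<in>V. (y v)\<^sup>2)" for y :: "'a \<Rightarrow> real"
  \<comment> \<open>Functions vanishing off \<open>V\<close> with values in \<open>[-1, 1]\<close>: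
    a product of compact sets, hence compact, which contains all functions on the sphere once they
    are extended by \<open>0\<close>.\<close>
  define B where "B = (PiE UNIV (\<lambda>i. if i \<in> V then {-1..1} else {0}) :: ('a \<Rightarrow> real) set)"
  have contQ: "continuous_on UNIV Q" and contq: "continuous_on UNIV q"
    unfolding Q_def q_def by (intro continuous_intros continuous_on_product_coordinates)+
  have "compact B"
    unfolding B_def compactin_euclidean_iff[symmetric] euclidean_product_topology[symmetric] compactin_PiE
    by auto
  moreover have "closed {y. q y = 1}"
    using contq by (simp add: closed_Collect_eq)
  ultimately have "compact (B \<inter> {y. q y = 1})" by (rule compact_Int_closed)
  moreover have "B \<inter> {y. q y = 1} \<noteq> {}"
  proof -
    from ne obtain v where v: "v \<in> V" by auto
    have "(\<lambda>i. if i = v then 1 else 0) \<in> B \<inter> {y. q y = 1}"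
      using v fin by (auto simp: B_def q_def if_distrib[of "\<lambda>t. t\<^sup>2"] cong: if_cong)
    then show ?thesis by blast
  qed
  ultimately obtain x where x: "x \<in> B" "q x = 1"
    and xmax: "\<And>y. y \<in> B \<Longrightarrow> q y = 1 \<Longrightarrow> Q y \<le> Q x"
    using continuous_attains_sup[of "B \<inter> {y. q y = 1}" Q] continuous_on_subset[OF contQ] by auto
  have rayleigh: "Q y \<le> Q x * q y" for y
  proof (cases "q y = 0")
    case True
    then have "y v = 0" if "v \<in> V" for v
      using that fin unfolding q_def by (simp add: sum_nonneg_eq_0_iff)
    then show ?thesis unfolding True by (simp add: Q_def)
  next
    case False
    then have pos: "q y > 0" unfolding q_def using sum_nonneg[of V "\<lambda>v. (y v)\<^sup>2"] by auto
    define z where "z = (\<lambda>i. if i \<in> V then y i / sqrt (q y) else 0)"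
    have "q z = (\<Sum>v\<in>V. (y v)\<^sup>2 / q y)"
      unfolding q_def[of z] using pos by (intro sum.cong) (auto simp: z_def power_divide)
    then have qz: "q z = 1" using pos unfolding sum_divide_distrib[symmetric] q_def[symmetric] by simp
    have "- 1 \<le> z i \<and> z i \<le> 1" if "i \<in> V" for i
    proof -
      have "(z i)\<^sup>2 \<le> q z" unfolding q_def using that fin by (intro member_le_sum) auto
      then show ?thesis using qz abs_square_le_1[of "z i"] by (simp add: abs_le_iff minus_le_iff)
    qed
    moreover have "z i = 0" if "i \<notin> V" for i using that by (simp add: z_def)
    ultimately have "z \<in> B" by (auto simp: B_def PiE_iff)
    from xmax[OF this qz] have "Q z \<le> Q x" .
    moreover have "Q z = (\<Sum>v\<in>V. \<Sum>u\<in>V. a v u * y v * y u / q y)"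
      unfolding Q_def using pos by (intro sum.cong) (auto simp: z_def field_simps)
    then have "Q z = Q y / q y" unfolding sum_divide_distrib[symmetric] Q_def .
    ultimately show ?thesis using pos by (simp add: field_simps)
  qed
  have eig: "(\<Sum>u\<in>V. a w u * x u) = Q x * x w" if w: "w \<in> V" for w
  proof -
    define b where "b = (\<Sum>u\<in>V. a w u * x u) - Q x * x w"
    \<comment> \<open>Perturbing \<open>x\<close> at the single vertex \<open>w\<close> by
      \<open>s\<close> turns the Rayleigh bound into a quadratic inequality in \<open>s\<close>,
      whose linear coefficient \<open>2 * b\<close> must vanish.\<close>
    have ineq: "2 * s * b + s\<^sup>2 * (a w w - Q x) \<le> 0" for s
    proof -
      let ?e = "\<lambda>i. if i = w then s else 0"
      let ?y = "\<lambda>i. x i + ?e i"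
      have "q ?y = (\<Sum>v\<in>V. (x v)\<^sup>2 + (if v = w then 2 * s * x w + s\<^sup>2 else 0))"
        unfolding q_def by (intro sum.cong) (auto simp: power2_sum)
      then have 1: "q ?y = 1 + 2 * s * x w + s\<^sup>2"
        using x(2) w fin by (simp add: sum.distrib q_def)
      have "Q ?y = (\<Sum>v\<in>V. \<Sum>u\<in>V. a v u * x v * x u + (if u = w then a v w * x v * s else 0)
          + (if v = w then a w u * s * x u + (if u = w then a w w * s\<^sup>2 else 0) else 0))"
        unfolding Q_def by (intro sum.cong) (auto simp: algebra_simps power2_eq_square)
      also have "\<dots> = (\<Sum>v\<in>V. (\<Sum>u\<in>V. a v u * x v * x u) + a v w * x v * s
          + (if v = w then (\<Sum>u\<in>V. a w u * s * x u) + a w w * s\<^sup>2 else 0))"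
        using w fin by (intro sum.cong) (auto simp: sum.distrib)
      also have "\<dots> = Q x + (\<Sum>v\<in>V. a v w * x v * s) + (\<Sum>u\<in>V. a w u * s * x u) + a w w * s\<^sup>2"
        using w fin by (simp add: sum.distrib Q_def)
      also have "(\<Sum>v\<in>V. a v w * x v * s) = s * (\<Sum>u\<in>V. a w u * x u)"
        unfolding sum_distrib_left using sym w by (intro sum.cong) auto
      also have "(\<Sum>u\<in>V. a w u * s * x u) = s * (\<Sum>u\<in>V. a w u * x u)"
        unfolding sum_distrib_left by (intro sum.cong) auto
      finally have "Q ?y = Q x + 2 * s * (\<Sum>u\<in>V. a w u * x u) + a w w * s\<^sup>2" by simp
      with rayleigh[of ?y] 1 show ?thesis unfolding b_def by (simp add: algebra_simps)
    qed
    have "b = 0"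
    proof (rule ccontr)
      assume b: "b \<noteq> 0"
      \<comment> \<open>At \<open>s = b / M\<close> the linear term is
        \<open>2 * b\<^sup>2 / M\<close>, while the quadratic one is at least
        \<open>- b\<^sup>2 / M\<close>.\<close>
      define M where "M = \<bar>a w w - Q x\<bar> + 1"
      have M: "M > 0" "- M \<le> a w w - Q x" unfolding M_def by linarith+
      have "2 * (b / M) * b + (b / M)\<^sup>2 * (- M) \<le> 2 * (b / M) * b + (b / M)\<^sup>2 * (a w w - Q x)"
        using M by (intro add_left_mono mult_left_mono) auto
      also have "\<dots> \<le> 0" by (rule ineq)
      also have "2 * (b / M) * b + (b / M)\<^sup>2 * (- M) = b\<^sup>2 / M"
        using M by (simp add: field_simps power2_eq_square)
      finally show False using b M by (simp add: divide_le_0_iff)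
    qed
    then show ?thesis unfolding b_def by simp
  qed
  have "\<exists>v\<in>V. x v \<noteq> 0"
    using x(2) unfolding q_def by (metis (no_types, lifting) sum.neutral zero_neq_one zero_power2)
  then show thesis
    by (rule that[OF _ eig]) (use rayleigh in \<open>auto simp: Q_def q_def\<close>)
qed

section \<open>Adjacency spectra in terms of functions on vertices\<close>

definition nbrs :: "'a pair_pre_digraph \<Rightarrow> 'a \<Rightarrow> 'a set" where
  "nbrs T v = {u. (v, u) \<in> parcs T}"

lemma (in pair_fin_digraph) nbrs_subset: "nbrs G v \<subseteq> pverts G"
  by (auto simp: nbrs_def dest: in_arcsD2)

lemma (in pair_fin_digraph) finite_nbrs: "finite (nbrs G v)"
  using nbrs_subset pair_finite_verts by (rule finite_subset)

lemma out_degree_with_proj: "out_degree (with_proj T) v = card (nbrs T v)"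
proof -
  have "out_arcs (with_proj T) v = Pair v ` nbrs T v"
    by (auto simp: out_arcs_def nbrs_def)
  then show ?thesis by (simp add: out_degree_def card_image inj_on_def)
qed

lemma (in pair_fin_digraph) sum_nbrs:
  "(\<Sum>u\<in>pverts G. (if (v, u) \<in> parcs G then 1 else 0) * f u) = (\<Sum>u\<in>nbrs G v. f u :: real)"
proof -
  have "(\<Sum>u\<in>nbrs G v. f u) = (\<Sum>u\<in>nbrs G v. (if (v, u) \<in> parcs G then 1 else 0) * f u)"
    by (intro sum.cong) (auto simp: nbrs_def)
  also have "\<dots> = (\<Sum>u\<in>pverts G. (if (v, u) \<in> parcs G then 1 else 0) * f u)"
    using nbrs_subset pair_finite_verts by (intro sum.mono_neutral_left) (auto simp: nbrs_def)
  finally show ?thesis ..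
qed

lemma adjacency_matrix_carrier:
  "adjacency_matrix T \<in> carrier_mat (card (pverts T)) (card (pverts T))"
  by (simp add: adjacency_matrix_def Let_def)

text \<open>Removes matrices and the vertex enumeration from everything that follows.\<close>

lemma mem_spectrum_adjacency_iff:
  assumes "pair_fin_digraph T"
  shows "\<mu> \<in> spectrum (adjacency_matrix T) \<longleftrightarrow>
    (\<exists>x. (\<exists>v\<in>pverts T. x v \<noteq> 0) \<and> (\<forall>v\<in>pverts T. (\<Sum>u\<in>nbrs T v. x u) = \<mu> * x v))"
    (is "_ \<longleftrightarrow> (\<exists>x. ?nz x \<and> ?eig x)")
proof -
  interpret pair_fin_digraph T by fact
  define vs where "vs = sorted_list_of_set (pverts T)"
  define n where "n = length vs"
  have dist: "distinct vs" and set_vs: "set vs = pverts T"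
    using pair_finite_verts by (auto simp: vs_def)
  have bij: "bij_betw ((!) vs) {..<n} (pverts T)"
    using bij_betw_nth[OF dist] set_vs by (simp add: n_def)
  have A: "adjacency_matrix T = mat n n (\<lambda>(i, j). if (vs ! i, vs ! j) \<in> parcs T then 1 else 0)"
    unfolding adjacency_matrix_def vs_def n_def Let_def ..
  have row: "(adjacency_matrix T *\<^sub>v vec n (\<lambda>i. x (vs ! i))) $ i = (\<Sum>u\<in>nbrs T (vs ! i). x u)"
    if "i < n" for x i
  proof -
    have "(adjacency_matrix T *\<^sub>v vec n (\<lambda>i. x (vs ! i))) $ i =
        (\<Sum>j<n. (if (vs ! i, vs ! j) \<in> parcs T then 1 else 0) * x (vs ! j))"
      using that unfolding A by (simp add: scalar_prod_def lessThan_atLeast0)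
    also have "\<dots> = (\<Sum>u\<in>pverts T. (if (vs ! i, u) \<in> parcs T then 1 else 0) * x u)"
      using sum.reindex_bij_betw[OF bij] by fast
    finally show ?thesis unfolding sum_nbrs .
  qed
  have eigenvector: "eigenvector (adjacency_matrix T) (vec n (\<lambda>i. x (vs ! i))) \<mu> \<longleftrightarrow> ?nz x \<and> ?eig x" for x
  proof -
    have "?nz x \<longleftrightarrow> (\<exists>i<n. x (vs ! i) \<noteq> 0)" "?eig x \<longleftrightarrow> (\<forall>i<n. (\<Sum>u\<in>nbrs T (vs ! i). x u) = \<mu> * x (vs ! i))"
      unfolding set_vs[symmetric] n_def by (simp_all only: set_conv_nth) auto
    moreover have "dim_row (adjacency_matrix T) = n" by (simp add: A)
    ultimately show ?thesis
      unfolding eigenvector_def using row by (auto simp: vec_eq_iff)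
  qed
  have surj: "\<exists>x. v = vec n (\<lambda>i. x (vs ! i))" if "v \<in> carrier_vec n" for v :: "real vec"
  proof
    have "inv_into {..<n} ((!) vs) (vs ! i) = i" if "i < n" for i
      using bij that by (simp add: bij_betw_def inv_into_f_f)
    then show "v = vec n (\<lambda>i. (\<lambda>u. v $ inv_into {..<n} ((!) vs) u) (vs ! i))"
      using that by (auto simp: vec_eq_iff)
  qed
  have "\<mu> \<in> spectrum (adjacency_matrix T) \<longleftrightarrow>
      (\<exists>v \<in> carrier_vec n. eigenvector (adjacency_matrix T) v \<mu>)"
    by (auto simp: spectrum_def eigenvalue_def eigenvector_def A)
  also have "\<dots> \<longleftrightarrow> (\<exists>x. eigenvector (adjacency_matrix T) (vec n (\<lambda>i. x (vs ! i))) \<mu>)"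
    using surj by (metis vec_carrier)
  finally show ?thesis unfolding eigenvector .
qed

text \<open>The Collatz-Wielandt bound: at a vertex maximising \<open>\<bar>x v\<bar> / h v\<close>,
  the triangle inequality in the eigenvalue equation gives the claim. It serves both to identify the
  spectral radius and to bound it strictly.\<close>

lemma eigenvalue_le_supersolution:
  assumes "pair_fin_digraph T" and "\<mu> \<in> spectrum (adjacency_matrix T)"
    and pos: "\<And>v. v \<in> pverts T \<Longrightarrow> h v > 0"
  obtains v where "v \<in> pverts T" "\<bar>\<mu>\<bar> * h v \<le> (\<Sum>u\<in>nbrs T v. h u :: real)"
proof -
  interpret pair_fin_digraph T by fact
  from assms(2) obtain x w where w: "w \<in> pverts T" "x w \<noteq> 0"
    and eig: "\<And>v. v \<in> pverts T \<Longrightarrow> (\<Sum>u\<in>nbrs T v. x u) = \<mu> * x v"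
    using mem_spectrum_adjacency_iff[OF assms(1)] by auto
  define R where "R = Max ((\<lambda>v. \<bar>x v\<bar> / h v) ` pverts T)"
  have "R \<in> (\<lambda>v. \<bar>x v\<bar> / h v) ` pverts T"
    unfolding R_def using pair_finite_verts w by (intro Max_in) auto
  then obtain v where v: "v \<in> pverts T" "R = \<bar>x v\<bar> / h v" by auto
  have le: "\<bar>x u\<bar> \<le> R * h u" if "u \<in> pverts T" for u
  proof -
    have "\<bar>x u\<bar> / h u \<le> R" unfolding R_def using pair_finite_verts that by (intro Max_ge) auto
    then show ?thesis using pos[OF that] by (simp add: field_simps)
  qed
  have "R * h w > 0" using le[OF w(1)] w(2) by linarith
  then have R: "R > 0" using pos[OF w(1)] by (simp add: zero_less_mult_iff)
  have "R * (\<bar>\<mu>\<bar> * h v) = \<bar>\<Sum>u\<in>nbrs T v. x u\<bar>"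
    unfolding eig[OF v(1)] v(2) using pos[OF v(1)] by (simp add: abs_mult)
  also have "\<dots> \<le> (\<Sum>u\<in>nbrs T v. R * h u)"
    using le nbrs_subset by (intro order_trans[OF sum_abs] sum_mono) auto
  also have "\<dots> = R * (\<Sum>u\<in>nbrs T v. h u)" by (simp add: sum_distrib_left)
  finally have "\<bar>\<mu>\<bar> * h v \<le> (\<Sum>u\<in>nbrs T v. h u)" using R by simp
  with v(1) show thesis by (rule that)
qed

lemma finite_spectrum_adjacency: "finite (spectrum (adjacency_matrix T))"
  using card_finite_spectrum(1)[OF adjacency_matrix_carrier] .

lemma graph_spectral_radius_eqI:
  assumes "pair_fin_digraph T" and "pverts T \<noteq> {}" and pos: "\<And>v. v \<in> pverts T \<Longrightarrow> h v > 0"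
    and eig: "\<And>v. v \<in> pverts T \<Longrightarrow> (\<Sum>u\<in>nbrs T v. h u) = \<mu> * h v"
  shows "graph_spectral_radius T = \<mu>"
  unfolding graph_spectral_radius_def
proof (rule Max_eqI[OF finite_spectrum_adjacency])
  have "\<exists>v\<in>pverts T. h v \<noteq> 0" using assms(2) pos by (metis all_not_in_conv less_irrefl)
  with eig show "\<mu> \<in> spectrum (adjacency_matrix T)"
    unfolding mem_spectrum_adjacency_iff[OF assms(1)] by blast
next
  fix \<nu> assume "\<nu> \<in> spectrum (adjacency_matrix T)"
  then obtain v where "v \<in> pverts T" "\<bar>\<nu>\<bar> * h v \<le> (\<Sum>u\<in>nbrs T v. h u)"
    using eigenvalue_le_supersolution[where h = h, OF assms(1) _ pos] by blast
  with eig pos show "\<nu> \<le> \<mu>" by fastforce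
qed

text \<open>The maximising eigenfunction shows that the spectrum is nonempty, so \<open>Max\<close>
  is attained; its eigenvalue is at most the radius, which therefore inherits the Rayleigh
  bound.\<close>

lemma graph_spectral_radius_rayleigh:
  assumes "pair_graph T" and "pverts T \<noteq> {}"
  shows "graph_spectral_radius T \<in> spectrum (adjacency_matrix T)"
    and "(\<Sum>v\<in>pverts T. y v * (\<Sum>u\<in>nbrs T v. y u)) \<le> graph_spectral_radius T * (\<Sum>v\<in>pverts T. (y v)\<^sup>2)"
proof -
  interpret pair_graph T by fact
  let ?a = "\<lambda>v u. if (v, u) \<in> parcs T then 1 else 0 :: real"
  obtain x \<mu> where nz: "\<exists>v\<in>pverts T. x v \<noteq> 0"
    and eig: "\<And>v. v \<in> pverts T \<Longrightarrow> (\<Sum>u\<in>pverts T. ?a v u * x u) = \<mu> * x v"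
    and rayleigh: "\<And>y. (\<Sum>v\<in>pverts T. \<Sum>u\<in>pverts T. ?a v u * y v * y u) \<le> \<mu> * (\<Sum>v\<in>pverts T. (y v)\<^sup>2)"
    by (rule ex_max_eigenfunction[OF pair_finite_verts assms(2), of ?a]) (use arcs_symmetric in auto)
  have \<mu>: "\<mu> \<in> spectrum (adjacency_matrix T)"
    unfolding mem_spectrum_adjacency_iff[OF pair_fin_digraph] using nz eig unfolding sum_nbrs by blast
  then show "graph_spectral_radius T \<in> spectrum (adjacency_matrix T)"
    unfolding graph_spectral_radius_def by (intro Max_in finite_spectrum_adjacency) auto
  have "\<mu> \<le> graph_spectral_radius T"
    unfolding graph_spectral_radius_def by (rule Max_ge[OF finite_spectrum_adjacency \<mu>])
  then have "\<mu> * (\<Sum>v\<in>pverts T. (y v)\<^sup>2) \<le> graph_spectral_radius T * (\<Sum>v\<in>pverts T. (y v)\<^sup>2)"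
    by (intro mult_right_mono sum_nonneg) auto
  moreover have "(\<Sum>v\<in>pverts T. y v * (\<Sum>u\<in>nbrs T v. y u)) =
      (\<Sum>v\<in>pverts T. \<Sum>u\<in>pverts T. ?a v u * y v * y u)"
    unfolding sum_nbrs[symmetric] sum_distrib_left by (simp add: mult_ac)
  ultimately show "(\<Sum>v\<in>pverts T. y v * (\<Sum>u\<in>nbrs T v. y u)) \<le> graph_spectral_radius T * (\<Sum>v\<in>pverts T. (y v)\<^sup>2)"
    using rayleigh[of y] by linarith
qed

text \<open>The test function below is the Perron eigenfunction of the star at \<open>w\<close>.\<close>

lemma sqrt_degree_le_spectral_radius:
  assumes "pair_graph T" and w: "w \<in> pverts T"
  shows "sqrt (card (nbrs T w)) \<le> graph_spectral_radius T"
proof (cases "nbrs T w = {}")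
  case True
  interpret pair_graph T by fact
  have "(\<Sum>v\<in>pverts T. of_bool (v = w) * (\<Sum>u\<in>nbrs T v. of_bool (u = w))) \<le>
      graph_spectral_radius T * (\<Sum>v\<in>pverts T. (of_bool (v = w))\<^sup>2)"
    using assms by (intro graph_spectral_radius_rayleigh) auto
  moreover have "(\<Sum>v\<in>pverts T. (of_bool (v = w) :: real)\<^sup>2) = 1"
    using w pair_finite_verts by (simp add: of_bool_def if_distrib[of "\<lambda>t. t\<^sup>2"] cong: if_cong)
  moreover have "(\<Sum>v\<in>pverts T. of_bool (v = w) * (\<Sum>u\<in>nbrs T v. of_bool (u = w))) \<ge> (0 :: real)"
    by (intro sum_nonneg mult_nonneg_nonneg) auto
  ultimately show ?thesis using True by simp
next
  case False
  interpret pair_graph T by fact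
  let ?N = "nbrs T w"
  define d where "d = real (card ?N)"
  have d: "d > 0" using False finite_nbrs unfolding d_def by (simp add: card_gt_0_iff)
  define y where "y v = (if v = w then sqrt d else if v \<in> ?N then 1 else 0)" for v
  have wN: "w \<notin> ?N" using no_loops' by (auto simp: nbrs_def)
  have y0: "y v \<ge> 0" for v using d by (simp add: y_def)
  have sub: "insert w ?N \<subseteq> pverts T" using w nbrs_subset by auto
  have "(\<Sum>v\<in>pverts T. (y v)\<^sup>2) = (\<Sum>v\<in>insert w ?N. (y v)\<^sup>2)"
    using sub pair_finite_verts by (intro sum.mono_neutral_right) (auto simp: y_def)
  also have "\<dots> = (y w)\<^sup>2 + (\<Sum>v\<in>?N. (y v)\<^sup>2)"
    using wN finite_nbrs by simp
  also have "(\<Sum>v\<in>?N. (y v)\<^sup>2) = (\<Sum>v\<in>?N. 1)"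
    using wN by (intro sum.cong) (auto simp: y_def)
  also have "(y w)\<^sup>2 = d" using d by (simp add: y_def)
  finally have sq: "(\<Sum>v\<in>pverts T. (y v)\<^sup>2) = 2 * d" by (simp add: d_def)
  have yN: "(\<Sum>u\<in>?N. y u) = d"
  proof -
    have "(\<Sum>u\<in>?N. y u) = (\<Sum>u\<in>?N. 1)" using wN by (intro sum.cong) (auto simp: y_def)
    then show ?thesis by (simp add: d_def)
  qed
  have leaf: "sqrt d \<le> y v * (\<Sum>u\<in>nbrs T v. y u)" if "v \<in> ?N" for v
  proof -
    have "w \<in> nbrs T v" using that arcs_symmetric by (auto simp: nbrs_def)
    then have "y w \<le> (\<Sum>u\<in>nbrs T v. y u)"
      using finite_nbrs y0 by (intro member_le_sum) auto
    moreover have "y v = 1" using that wN by (auto simp: y_def)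
    ultimately show ?thesis by (simp add: y_def)
  qed
  \<comment> \<open>The centre contributes \<open>d * sqrt d\<close>, and each of the
    \<open>d\<close> neighbours at least \<open>sqrt d\<close> through its arc back to
    \<open>w\<close>.\<close>
  have "2 * d * sqrt d = y w * (\<Sum>u\<in>nbrs T w. y u) + (\<Sum>v\<in>?N. sqrt d)"
    unfolding yN by (simp add: y_def d_def)
  also have "\<dots> \<le> y w * (\<Sum>u\<in>nbrs T w. y u) + (\<Sum>v\<in>?N. y v * (\<Sum>u\<in>nbrs T v. y u))"
    by (intro add_left_mono sum_mono leaf)
  also have "\<dots> = (\<Sum>v\<in>insert w ?N. y v * (\<Sum>u\<in>nbrs T v. y u))"
    using wN finite_nbrs by simp
  also have "\<dots> \<le> (\<Sum>v\<in>pverts T. y v * (\<Sum>u\<in>nbrs T v. y u))"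
    using sub pair_finite_verts y0 by (intro sum_mono2) (auto intro: mult_nonneg_nonneg sum_nonneg)
  also have "\<dots> \<le> graph_spectral_radius T * (\<Sum>v\<in>pverts T. (y v)\<^sup>2)"
    using assms by (intro graph_spectral_radius_rayleigh) auto
  finally have "2 * d * sqrt d \<le> graph_spectral_radius T * (2 * d)" unfolding sq .
  then show ?thesis using d by (simp add: d_def)
qed

section \<open>Depth in a tree\<close>

locale graph_tree = pair_graph T for T :: "'a :: linorder pair_pre_digraph" +
  assumes conn: "Digraph_Component.connected (with_proj T)"
    and acyclic: "\<And>p. cycle p \<Longrightarrow> length p < 3"
begin

lemma connected_rtrancl:
  assumes "u \<in> pverts T" "v \<in> pverts T"
  shows "(u, v) \<in> (parcs T)\<^sup>*"
proof -
  have "u \<rightarrow>\<^sup>*\<^bsub>with_proj (mk_symmetric (with_proj T))\<^esub> v"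
    using conn assms by (auto simp: Digraph_Component.connected_def strongly_connected_def)
  then have "(u, v) \<in> (parcs (mk_symmetric (with_proj T)))\<^sup>*"
    by (auto simp: reachable_def dest: rtrancl_on_rtranclI)
  moreover have "parcs (mk_symmetric (with_proj T)) = parcs T"
    using arcs_symmetric by (auto simp: parcs_mk_symmetric)
  ultimately show ?thesis by simp
qed

lemma walk_avoiding:
  assumes "(a, b) \<in> (parcs T \<inter> (- {v}) \<times> (- {v}))\<^sup>*" "a \<in> pverts T" "a \<noteq> v"
  shows "\<exists>p. awalk a p b \<and> v \<notin> set (awalk_verts a p)"
  using assms
proof (induction rule: converse_rtrancl_induct)
  case base
  then show ?case by (intro exI[of _ "[]"]) (simp add: awalk_Nil_iff)
next
  case (step a a')
  then obtain p where "awalk a' p b" "v \<notin> set (awalk_verts a' p)"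
    by (auto dest: in_arcsD2)
  then show ?case using step by (intro exI[of _ "(a, a') # p"]) (auto simp: awalk_Cons_iff)
qed

text \<open>Otherwise a path from \<open>u1\<close> to \<open>u2\<close> avoiding \<open>v\<close>
  would close up through \<open>v\<close> to a cycle; its length is at least three since the path is
  nonempty.\<close>

lemma cut_vertex:
  assumes "u1 \<in> nbrs T v" "u2 \<in> nbrs T v" "(u1, u2) \<in> (parcs T \<inter> (- {v}) \<times> (- {v}))\<^sup>*"
  shows "u1 = u2"
proof (rule ccontr)
  assume ne: "u1 \<noteq> u2"
  have arcs: "(v, u1) \<in> parcs T" "(u2, v) \<in> parcs T"
    using assms arcs_symmetric by (auto simp: nbrs_def)
  from arcs obtain p where p: "awalk u1 p u2" "v \<notin> set (awalk_verts u1 p)"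
    using walk_avoiding[OF assms(3)] no_loops' in_arcsD2 by blast
  define q where "q = awalk_to_apath p"
  have q: "apath u1 q u2" unfolding q_def by (rule apath_awalk_to_apath[OF p(1)])
  then have q': "awalk u1 q u2" by (rule awalkI_apath)
  have "set q \<subseteq> set p" unfolding q_def by (rule awalk_to_apath_subset[OF p(1)])
  then have vq: "v \<notin> set (awalk_verts u1 q)"
    using p(2) set_awalk_verts[OF p(1)] set_awalk_verts[OF q'] by auto
  have last: "awalk u2 [(u2, v)] v"
    using arcs in_arcsD2 by (simp add: awalk_simps)
  have walk: "awalk u1 (q @ [(u2, v)]) v" by (rule awalk_appendI[OF q' last])
  have "awalk_verts u1 (q @ [(u2, v)]) = awalk_verts u1 q @ [v]"
    using awalk_verts_append[OF walk] by simp
  then have "cycle ((v, u1) # q @ [(u2, v)])"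
    unfolding cycle_def using walk arcs in_arcsD1 q vq
    by (intro exI[of _ v]) (auto simp: awalk_Cons_iff apath_def simp del: awalk_append_iff)
  moreover have "q \<noteq> []" using ne q' by (auto simp: awalk_Nil_iff)
  ultimately show False using acyclic by fastforce
qed

section \<open>Distance from a chosen root, and parents\<close>

definition dep :: "'a \<Rightarrow> 'a \<Rightarrow> nat" where
  "dep r v = (LEAST n. (r, v) \<in> parcs T ^^ n)"

context
  fixes r assumes r: "r \<in> pverts T"
begin

lemma dep_relpow: "v \<in> pverts T \<Longrightarrow> (r, v) \<in> parcs T ^^ dep r v"
  unfolding dep_def using connected_rtrancl[OF r] by (metis LeastI rtrancl_imp_relpow)

lemma dep_le: "(r, v) \<in> parcs T ^^ n \<Longrightarrow> dep r v \<le> n"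
  unfolding dep_def by (rule Least_le)

lemma dep_zero_iff: "v \<in> pverts T \<Longrightarrow> dep r v = 0 \<longleftrightarrow> v = r"
  using dep_relpow[of v] dep_le[of v 0] by auto

lemma dep_nbr: "u \<in> nbrs T v \<Longrightarrow> dep r u \<le> Suc (dep r v)"
  using dep_relpow[of v] by (intro dep_le) (auto simp: nbrs_def dest: in_arcsD1)

lemma ex_parent:
  assumes "v \<in> pverts T" "v \<noteq> r"
  shows "\<exists>u\<in>nbrs T v. dep r v = Suc (dep r u)"
proof -
  obtain n where n: "dep r v = Suc n"
    using dep_zero_iff[OF assms(1)] assms(2) by (cases "dep r v") auto
  with dep_relpow[OF assms(1)] obtain u where u: "(r, u) \<in> parcs T ^^ n" "(u, v) \<in> parcs T"
    by auto
  then have nbr: "u \<in> nbrs T v" "v \<in> nbrs T u" using arcs_symmetric by (auto simp: nbrs_def)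
  with dep_nbr[OF nbr(2)] dep_le[OF u(1)] n show ?thesis by (intro bexI[of _ u]) auto
qed

text \<open>Climbing from parent to parent strictly decreases the depth, so \<open>v\<close>, which
  is at least as deep as the start, is never met.\<close>

lemma reach_root_avoiding:
  "u \<in> pverts T \<Longrightarrow> u \<noteq> v \<Longrightarrow> dep r u \<le> dep r v \<Longrightarrow> (u, r) \<in> (parcs T \<inter> (- {v}) \<times> (- {v}))\<^sup>*"
proof (induction "dep r u" arbitrary: u rule: less_induct)
  case less
  show ?case
  proof (cases "u = r")
    case False
    then obtain u' where u': "u' \<in> nbrs T u" "dep r u = Suc (dep r u')"
      using ex_parent less.prems(1) by blast
    then have "u' \<noteq> v" using less.prems by auto
    moreover have "(u, u') \<in> parcs T" using u' by (simp add: nbrs_def)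
    moreover have "(u', r) \<in> (parcs T \<inter> (- {v}) \<times> (- {v}))\<^sup>*"
      using less.hyps[of u'] u' less.prems nbrs_subset \<open>u' \<noteq> v\<close> by auto
    ultimately show ?thesis using less.prems by (intro converse_rtrancl_into_rtrancl[of u u']) auto
  qed simp
qed

text \<open>Both neighbours climb to the root without meeting \<open>v\<close>, so
  \<open>cut_vertex\<close> applies. Hence every neighbour except the parent lies exactly one level
  deeper.\<close>

lemma parent_unique:
  assumes "u1 \<in> nbrs T v" "u2 \<in> nbrs T v" "dep r u1 \<le> dep r v" "dep r u2 \<le> dep r v"
  shows "u1 = u2"
proof (rule cut_vertex[OF assms(1,2)])
  let ?R = "parcs T \<inter> (- {v}) \<times> (- {v})"
  have "u1 \<noteq> v" "u2 \<noteq> v" using assms no_loops' by (auto simp: nbrs_def)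
  then have "(u1, r) \<in> ?R\<^sup>*" "(u2, r) \<in> ?R\<^sup>*"
    using assms nbrs_subset by (auto intro!: reach_root_avoiding)
  moreover have "sym (?R\<^sup>*)"
    by (rule sym_rtrancl) (use arcs_symmetric in \<open>auto simp: sym_def\<close>)
  ultimately show "(u1, u2) \<in> ?R\<^sup>*" by (meson rtrancl_trans symD)
qed

text \<open>
  On the infinite \<open>(d + 1)\<close>-regular tree, \<open>d powr (- n / 2) * a n\<close> at depth \<open>n\<close> satisfies the eigenvalue equation for
  \<open>2 sqrt d\<close> away from the root if \<open>a\<close> is affine; a strictly concave \<open>a\<close> gives strict inequality.
\<close>

lemma strict_supersolution:
  fixes d :: nat
  assumes deg: "\<And>v. v \<in> pverts T \<Longrightarrow> card (nbrs T v) \<le> d + 1" and d: "d \<ge> 1"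
  obtains h where "\<And>v. v \<in> pverts T \<Longrightarrow> h v > 0"
    "\<And>v. v \<in> pverts T \<Longrightarrow> (\<Sum>u\<in>nbrs T v. h u) < 2 * sqrt d * h v"
proof
  define N where "N = Suc (Max (dep r ` pverts T))"
  have N: "dep r v < N" if "v \<in> pverts T" for v
    unfolding N_def less_Suc_eq_le using that pair_finite_verts by (intro Max_ge) auto
  \<comment> \<open>Strictly concave with constant second difference \<open>- 2\<close>, positive at
    every depth that occurs and still nonnegative one level below.\<close>
  define a where "a n = (real N)\<^sup>2 - (real n)\<^sup>2" for n
  define h where "h v = (1 / sqrt d) ^ dep r v * a (dep r v)" for v
  have s: "sqrt d > 0" using d by simp
  have a0: "a n \<ge> 0" if "n \<le> N" for n using that by (simp add: a_def power_mono)
  have a_pos: "a n > 0" if "n < N" for n using that by (simp add: a_def power_strict_mono)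
  show "h v > 0" if "v \<in> pverts T" for v
    using a_pos[OF N[OF that]] s by (simp add: h_def)
  show "(\<Sum>u\<in>nbrs T v. h u) < 2 * sqrt d * h v" if v: "v \<in> pverts T" for v
  proof (cases "v = r")
    case True
    have "h u = (1 / sqrt d) * a 1" if "u \<in> nbrs T v" for u
    proof -
      have "u \<noteq> r" using that True no_loops' by (auto simp: nbrs_def)
      then have "dep r u = 1"
        using dep_nbr[OF that] dep_zero_iff[of u] dep_zero_iff[OF v] that nbrs_subset True
        by (auto simp: subset_iff)
      then show ?thesis by (simp add: h_def)
    qed
    then have "(\<Sum>u\<in>nbrs T v. h u) = card (nbrs T v) * (1 / sqrt d * a 1)" by simp
    \<comment> \<open>The root may have \<open>d + 1\<close> children, which is at most
      \<open>2 * d\<close>; strictness comes from \<open>a 1 < a 0\<close>.\<close>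
    also have "\<dots> \<le> real (2 * d) * (1 / sqrt d * a 1)"
      using deg[OF v] d a0[of 1] s by (intro mult_right_mono mult_nonneg_nonneg) (auto simp: N_def)
    also have "\<dots> < real (2 * d) * (1 / sqrt d * a 0)"
      using d s by (intro mult_strict_left_mono) (auto simp: a_def)
    also have "\<dots> = 2 * sqrt d * h v"
      using True v dep_zero_iff[OF v] s by (simp add: h_def field_simps)
    finally show ?thesis .
  next
    case False
    then obtain p where p: "p \<in> nbrs T v" "dep r v = Suc (dep r p)" using ex_parent v by blast
    define n where "n = dep r p"
    have "dep r u = Suc (Suc n)" if "u \<in> nbrs T v - {p}" for u
      using dep_nbr[of u v] parent_unique[of u v p] p that unfolding n_def by force
    then have "h u = (1 / sqrt d) ^ Suc (Suc n) * a (Suc (Suc n))" if "u \<in> nbrs T v - {p}" for u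
      using that by (simp add: h_def)
    then have "(\<Sum>u\<in>nbrs T v - {p}. h u) =
        card (nbrs T v - {p}) * ((1 / sqrt d) ^ Suc (Suc n) * a (Suc (Suc n)))" by simp
    also have "\<dots> \<le> real d * ((1 / sqrt d) ^ Suc (Suc n) * a (Suc (Suc n)))"
      using deg[OF v] finite_nbrs p s N[OF v] unfolding n_def
      by (intro mult_right_mono mult_nonneg_nonneg a0) auto
    also have "\<dots> = (1 / sqrt d) ^ n * a (Suc (Suc n))"
      using d by (simp add: power_divide field_simps)
    finally have "(\<Sum>u\<in>nbrs T v. h u) \<le> (1 / sqrt d) ^ n * (a n + a (Suc (Suc n)))"
      using sum.remove[OF finite_nbrs p(1), of h] by (simp add: h_def n_def algebra_simps)
    also have "\<dots> < (1 / sqrt d) ^ n * (2 * a (Suc n))"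
      using s by (intro mult_strict_left_mono) (auto simp: a_def power2_eq_square algebra_simps)
    also have "\<dots> = 2 * sqrt d * h v"
      using s p by (simp add: h_def n_def)
    finally show ?thesis .
  qed
qed

end

lemma spectral_radius_less:
  assumes deg: "\<And>v. v \<in> pverts T \<Longrightarrow> card (nbrs T v) \<le> d + 1" and d: "d \<ge> 1"
  shows "graph_spectral_radius T < 2 * sqrt d"
proof -
  have ne: "pverts T \<noteq> {}"
    using conn by (auto simp: Digraph_Component.connected_def strongly_connected_def)
  then obtain r where "r \<in> pverts T" by auto
  from strict_supersolution[OF this deg d] obtain h :: "'a \<Rightarrow> real" where
    pos: "\<And>v. v \<in> pverts T \<Longrightarrow> h v > 0" and
    h: "\<And>v. v \<in> pverts T \<Longrightarrow> (\<Sum>u\<in>nbrs T v. h u) < 2 * sqrt d * h v" by blast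
  from graph_spectral_radius_rayleigh(1)[OF pair_graph ne]
  obtain v where v: "v \<in> pverts T" "\<bar>graph_spectral_radius T\<bar> * h v \<le> (\<Sum>u\<in>nbrs T v. h u)"
    using eigenvalue_le_supersolution[where h = h, OF pair_fin_digraph _ pos] by blast
  with h[OF v(1)] have "\<bar>graph_spectral_radius T\<bar> * h v < 2 * sqrt d * h v" by linarith
  then show ?thesis using pos[OF v(1)] by simp
qed

end

lemma undirected_tree_iff: "undirected_tree T \<longleftrightarrow> graph_tree T"
  unfolding undirected_tree_def graph_tree_def graph_tree_axioms_def by (meson not_less)

section \<open>Trees given by a parent function\<close>

text \<open>Vertex \<open>0\<close> is the root. Numbering parents before children makes gluing a
  shift of indices.\<close>

definition parent_graph :: "nat \<Rightarrow> (nat \<Rightarrow> nat) \<Rightarrow> nat pair_pre_digraph" where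
  "parent_graph N p = \<lparr>pverts = {..<N},
     parcs = {(i, j). i < N \<and> j < N \<and> (0 < i \<and> p i = j \<or> 0 < j \<and> p j = i)}\<rparr>"

definition children :: "nat \<Rightarrow> (nat \<Rightarrow> nat) \<Rightarrow> nat \<Rightarrow> nat set" where
  "children N p i = {j. 0 < j \<and> j < N \<and> p j = i}"

lemma finite_children: "finite (children N p i)"
  by (simp add: children_def)

lemma pcas_nth_Suc: "pcas u c v \<Longrightarrow> Suc i < length c \<Longrightarrow> snd (c ! i) = fst (c ! Suc i)"
proof (induction c arbitrary: u i)
  case (Cons e c)
  then show ?case by (cases i; cases c) auto
qed simp

lemma pcas_last: "pcas u c v \<Longrightarrow> c \<noteq> [] \<Longrightarrow> snd (last c) = v"
  by (induction c arbitrary: u) (auto split: if_splits)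

lemma pcas_hd: "pcas u c v \<Longrightarrow> c \<noteq> [] \<Longrightarrow> fst (hd c) = u"
  by (cases c) auto

lemma pawalk_verts_pcas: "pcas u c v \<Longrightarrow> pawalk_verts u c = u # map snd c"
  by (induction c arbitrary: u) auto

lemma pcas_closed_nth:
  assumes "pcas u c u" "i < length c"
  shows "snd (c ! i) = fst (c ! (Suc i mod length c))"
proof (cases "Suc i < length c")
  case True
  then show ?thesis using pcas_nth_Suc[OF assms(1)] by simp
next
  case False
  then have i: "Suc i = length c" using assms(2) by simp
  then have "c \<noteq> []" "length c - 1 = i" by auto
  then show ?thesis using i pcas_last[OF assms(1)] pcas_hd[OF assms(1)]
    by (simp add: hd_conv_nth last_conv_nth)
qed

locale parent_function =
  fixes N :: nat and p :: "nat \<Rightarrow> nat"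
  assumes N: "N > 0" and parent_less: "\<And>i. 0 < i \<Longrightarrow> i < N \<Longrightarrow> p i < i"
begin

abbreviation "G \<equiv> parent_graph N p"

lemma pverts_parent_graph: "pverts G = {..<N}"
  by (simp add: parent_graph_def)

lemma pair_graph_parent_graph: "pair_graph G"
proof
  show "finite (parcs G)"
    by (rule finite_subset[of _ "{..<N} \<times> {..<N}"]) (auto simp: parent_graph_def)
  show "symmetric (with_proj G)"
    by (auto simp: symmetric_def sym_def parent_graph_def)
  have "p i \<noteq> i" "i \<noteq> p i" if "0 < i" "i < N" for i using parent_less[OF that] by auto
  then show "fst e \<noteq> snd e" if "e \<in> parcs G" for e
    using that by (auto simp: parent_graph_def)
qed (auto simp: parent_graph_def)

sublocale G: pair_graph G by (rule pair_graph_parent_graph)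

lemma nbrs_root: "nbrs G 0 = children N p 0"
  using N by (auto simp: nbrs_def children_def parent_graph_def)

lemma nbrs_nonroot: "0 < i \<Longrightarrow> i < N \<Longrightarrow> nbrs G i = insert (p i) (children N p i)"
  using parent_less[of i] by (auto simp: nbrs_def children_def parent_graph_def)

lemma parent_notin_children: "0 < i \<Longrightarrow> i < N \<Longrightarrow> p i \<notin> children N p i"
  using parent_less[of i] parent_less[of "p i"] by (auto simp: children_def)

lemma smaller_neighbor: "(i, j) \<in> parcs G \<Longrightarrow> j \<le> i \<Longrightarrow> j = p i"
  using parent_less[of j] parent_less[of i] by (auto simp: parent_graph_def)

lemma reachable_root: "i < N \<Longrightarrow> i \<rightarrow>\<^sup>*\<^bsub>with_proj G\<^esub> 0"
proof (induction i rule: less_induct)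
  case (less i)
  show ?case
  proof (cases "i = 0")
    case True
    then show ?thesis using N by (auto intro: G.reachable_refl simp: pverts_parent_graph)
  next
    case False
    then have "(i, p i) \<in> parcs G" "p i < i"
      using parent_less[of i] less.prems by (auto simp: parent_graph_def)
    then show ?thesis using less by (intro G.adj_reachable_trans[of i "p i"]) auto
  qed
qed

text \<open>At the largest vertex \<open>M\<close> of a cycle, predecessor and successor are both
  smaller neighbours, hence both equal \<open>p M\<close>. As vertices do not repeat, their cyclic
  positions agree and the length divides \<open>2\<close>.\<close>

lemma no_long_cycle:
  assumes "G.cycle c"
  shows "length c < 3"
proof (rule ccontr)
  assume "\<not> length c < 3"
  define n where "n = length c"
  have n: "n \<ge> 3" using \<open>\<not> length c < 3\<close> by (simp add: n_def)
  from assms obtain u where u: "G.awalk u c u" "distinct (tl (G.awalk_verts u c))" "c \<noteq> []"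
    by (auto simp: G.cycle_def)
  have cas: "pcas u c u" and arcs: "set c \<subseteq> parcs G" using u(1) by (auto simp: G.awalk_def)
  have "distinct (map snd c)" using u(2) pawalk_verts_pcas[OF cas] by simp
  then have inj: "i = j" if "i < n" "j < n" "snd (c ! i) = snd (c ! j)" for i j
    using that by (auto simp: distinct_conv_nth n_def)
  have next_arc: "snd (c ! i) = fst (c ! (Suc i mod n))" if "i < n" for i
    using pcas_closed_nth[OF cas] that by (simp add: n_def)
  define M where "M = Max (snd ` set c)"
  have M: "snd (c ! i) \<le> M" if "i < n" for i
    unfolding M_def using that by (intro Max_ge) (auto simp: n_def)
  have "M \<in> snd ` set c" unfolding M_def using u(3) by (intro Max_in) auto
  then obtain i where i: "i < n" "snd (c ! i) = M" by (auto simp: in_set_conv_nth n_def)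
  define j where "j = (i + (n - 1)) mod n"
  have j: "j < n" "Suc j mod n = i"
    using n i by (auto simp: j_def mod_Suc_eq)
  define l where "l = Suc i mod n"
  have l: "l < n" using n by (simp add: l_def)
  have arc: "c ! i' \<in> parcs G" if "i' < n" for i' using arcs that by (auto simp: n_def)
  have "c ! i = (snd (c ! j), M)" using next_arc[OF j(1)] j(2) i by (auto intro: prod_eqI)
  then have "(M, snd (c ! j)) \<in> parcs G" using arc[OF i(1)] G.arcs_symmetric by simp
  then have "snd (c ! j) = p M" using M[OF j(1)] smaller_neighbor by blast
  moreover have "c ! l = (M, snd (c ! l))"
    using next_arc[OF i(1)] i by (auto intro: prod_eqI simp: l_def)
  then have "(M, snd (c ! l)) \<in> parcs G" using arc[OF l] by simp
  then have "snd (c ! l) = p M" using M[OF l] smaller_neighbor by blast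
  ultimately have "j = l" using inj j(1) l by simp
  then have "Suc l mod n = i" using j by simp
  then have "(i + 2) mod n = i mod n" using i by (simp add: l_def mod_Suc_eq)
  then have "n dvd 2" using mod_eq_dvd_iff_nat[of i "i + 2" n] by simp
  then show False using n by (auto dest: dvd_imp_le)
qed

lemma undirected_tree_parent_graph: "undirected_tree G"
  unfolding undirected_tree_def
proof (intro conjI)
  have "u \<rightarrow>\<^sup>*\<^bsub>with_proj G\<^esub> v" if "u < N" "v < N" for u v
    using reachable_root[OF that(1)] reachable_root[OF that(2)]
    by (meson G.symmetric_reachable' G.reachable_trans)
  then show "Digraph_Component.connected (with_proj G)"
    using N by (auto simp: Digraph_Component.connected_def pverts_parent_graph
        intro!: strongly_connectedI G.reachable_mk_symmetricI)
  show "\<not> (\<exists>c. pre_digraph.cycle (with_proj G) c \<and> 3 \<le> length c)"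
    using no_long_cycle by (meson not_less)
qed (rule pair_graph_parent_graph)

end

text \<open>The eigenvalue equation for \<open>sqrt k\<close> is imposed away from the root only. At
  the root, \<open>s\<close> records the sum of the labels \<open>sqrt k * x j / x 0\<close> of the
  children, so the equation holds there too exactly when \<open>s = k\<close> (for
  \<open>k > 0\<close>).\<close>

definition realizes ::
  "nat \<Rightarrow> nat \<Rightarrow> nat \<Rightarrow> real \<Rightarrow> nat \<Rightarrow> (nat \<Rightarrow> nat) \<Rightarrow> (nat \<Rightarrow> real) \<Rightarrow> bool" where
  "realizes D k m s N p x \<longleftrightarrow> parent_function N p \<and> (\<forall>i<N. x i > 0) \<and>
     (\<forall>i. 0 < i \<longrightarrow> i < N \<longrightarrow> card (children N p i) \<le> D \<and>
        x (p i) + (\<Sum>j\<in>children N p i. x j) = sqrt k * x i) \<and>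
     card (children N p 0) = m \<and> sqrt k * (\<Sum>j\<in>children N p 0. x j) = s * x 0"

text \<open>The second tree is shifted by \<open>N\<close>, its root becoming a new child of
  \<open>0\<close>, and its function is rescaled. The equations at the other vertices are
  homogeneous and survive; only the two old roots need attention.\<close>

lemma realizes_attach:
  assumes A: "realizes D k m s N p x" and B: "realizes D k m' s' N' p' x'"
    and m': "m' \<le> D" and s': "s' < real k" and k: "k > 0"
  shows "\<exists>N p x. realizes D k (Suc m) (s + real k / (real k - s')) N p x"
proof -
  interpret A: parent_function N p using A by (simp add: realizes_def)
  interpret B: parent_function N' p' using B by (simp add: realizes_def)
  have x0: "x 0 > 0" "x' 0 > 0" using A B A.N B.N by (auto simp: realizes_def)
  define t where "t = real k / (real k - s')"
  have t: "t > 0" "(real k - s') * t = real k" using s' k by (auto simp: t_def)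
  have sk: "sqrt k > 0" "sqrt k * sqrt k = real k" using k by auto
  \<comment> \<open>Chosen so that the new child, with value \<open>\<alpha> * x' 0\<close>, has
    label \<open>t\<close>.\<close>
  define \<alpha> where "\<alpha> = x 0 * t / (sqrt k * x' 0)"
  have \<alpha>: "\<alpha> > 0" "sqrt k * (\<alpha> * x' 0) = t * x 0"
    using x0 t sk by (auto simp: \<alpha>_def)
  define P where "P j = (if j < N then p j else if j = N then 0 else N + p' (j - N))" for j
  define X where "X j = (if j < N then x j else \<alpha> * x' (j - N))" for j
  have ch_root: "children (N + N') P 0 = insert N (children N p 0)"
    using A.N B.N by (auto simp: children_def P_def)
  have ch_old: "children (N + N') P i = children N p i" if "0 < i" "i < N" for i
    using that by (auto simp: children_def P_def)
  have ch_new: "children (N + N') P (N + i) = (+) N ` children N' p' i" if "i < N'" for i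
  proof (intro equalityI subsetI)
    fix j assume "j \<in> children (N + N') P (N + i)"
    then have "N < j" "j < N + N'" "p' (j - N) = i"
      using A.N A.parent_less[of j] by (auto simp: children_def P_def split: if_splits)
    then show "j \<in> (+) N ` children N' p' i"
      by (intro image_eqI[of _ _ "j - N"]) (auto simp: children_def)
  qed (auto simp: children_def P_def)
  have notin: "N \<notin> children N p 0" by (simp add: children_def)
  have sum_old: "(\<Sum>j\<in>children N p i. X j) = (\<Sum>j\<in>children N p i. x j)" for i
    by (intro sum.cong) (auto simp: children_def X_def)
  have sum_new: "(\<Sum>j\<in>(+) N ` children N' p' i. X j) = \<alpha> * (\<Sum>j\<in>children N' p' i. x' j)" for i
    by (subst sum.reindex) (auto simp: X_def sum_distrib_left)
  have "realizes D k (Suc m) (s + t) (N + N') P X"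
    unfolding realizes_def
  proof (intro conjI allI impI)
    show "parent_function (N + N') P"
    proof
      fix i assume "0 < i" "i < N + N'"
      moreover from this have "i - N < N'" if "\<not> i < N" using that by linarith
      ultimately show "P i < i"
        using A.parent_less[of i] B.parent_less[of "i - N"] by (auto simp: P_def)
    qed (use A.N in simp)
    show "X i > 0" if "i < N + N'" for i
      using that A B \<alpha> by (auto simp: X_def realizes_def)
    show "card (children (N + N') P 0) = Suc m"
      using A notin by (simp add: ch_root finite_children realizes_def)
    have "sqrt k * (\<Sum>j\<in>children N p 0. x j) = s * x 0" using A by (simp add: realizes_def)
    then show "sqrt k * (\<Sum>j\<in>children (N + N') P 0. X j) = (s + t) * X 0"
      unfolding ch_root using notin A.N \<alpha>(2)
      by (simp add: finite_children sum_old distrib_left distrib_right) (simp add: X_def)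
    fix i assume i: "0 < i" "i < N + N'"
    consider "i < N" | "i = N" | j where "i = N + j" "0 < j" "j < N'"
      using i by (metis add_diff_inverse_nat nat_add_left_cancel_less neq0_conv less_diff_conv2 add.right_neutral)
    then have "card (children (N + N') P i) \<le> D \<and>
      X (P i) + (\<Sum>j\<in>children (N + N') P i. X j) = sqrt k * X i"
    proof cases
      case 1
      then have "X i = x i" "X (P i) = x (p i)" using i A.parent_less[of i] by (auto simp: X_def P_def)
      then show ?thesis using A i 1 by (simp add: ch_old sum_old realizes_def)
    next
      case 2
      have ch: "children (N + N') P N = (+) N ` children N' p' 0" using ch_new[of 0] B.N by simp
      have s0: "sqrt k * (\<Sum>j\<in>children N' p' 0. x' j) = s' * x' 0" "card (children N' p' 0) = m'"
        using B by (auto simp: realizes_def)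
      \<comment> \<open>The eigenvalue equation at the attached root is
        \<open>(k - s') * t = k\<close> in terms of labels.\<close>
      have "sqrt k * (x 0 + \<alpha> * (\<Sum>j\<in>children N' p' 0. x' j)) = sqrt k * (sqrt k * (\<alpha> * x' 0))"
      proof -
        have "sqrt k * (sqrt k * (x 0 + \<alpha> * (\<Sum>j\<in>children N' p' 0. x' j))) =
            (sqrt k * sqrt k) * x 0 + (sqrt k * \<alpha>) * (sqrt k * (\<Sum>j\<in>children N' p' 0. x' j))"
          by (simp add: algebra_simps)
        also have "\<dots> = real k * x 0 + s' * (sqrt k * (\<alpha> * x' 0))"
          unfolding sk(2) s0(1) by simp
        also have "\<dots> = real k * x 0 + s' * t * x 0" unfolding \<alpha>(2) by simp
        also have "real k * x 0 = (real k - s') * t * x 0" unfolding t(2) ..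
        also have "(real k - s') * t * x 0 + s' * t * x 0 = real k * (t * x 0)"
          by (simp add: algebra_simps)
        also have "\<dots> = sqrt k * (sqrt k * (sqrt k * (\<alpha> * x' 0)))"
          unfolding \<alpha>(2) by (simp flip: mult.assoc add: sk(2))
        finally show ?thesis using sk(1) by simp
      qed
      then have "x 0 + \<alpha> * (\<Sum>j\<in>children N' p' 0. x' j) = sqrt k * (\<alpha> * x' 0)"
        using sk(1) by simp
      then show ?thesis unfolding 2 ch sum_new using m' s0(2) A.N
        by (simp add: card_image X_def P_def)
    next
      case 3
      then have "x' (p' j) + (\<Sum>l\<in>children N' p' j. x' l) = sqrt k * x' j" "card (children N' p' j) \<le> D"
        using B by (auto simp: realizes_def)
      from this(1) have "\<alpha> * x' (p' j) + \<alpha> * (\<Sum>l\<in>children N' p' j. x' l) = sqrt k * (\<alpha> * x' j)"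
        by (metis distrib_left mult.left_commute)
      then show ?thesis unfolding 3(1) ch_new[OF 3(3)] sum_new
        using 3 \<open>card (children N' p' j) \<le> D\<close> by (simp add: card_image X_def P_def)
    qed
    then show "card (children (N + N') P i) \<le> D"
      "X (P i) + (\<Sum>j\<in>children (N + N') P i. X j) = sqrt k * X i" by blast+
  qed
  then show ?thesis unfolding t_def by blast
qed

lemma branch_realized:
  assumes "branch D k m s" "k > 0"
  shows "\<exists>N p x. realizes D k m s N p x"
  using assms(1)
proof induction
  case single
  have "realizes D k 0 0 1 (\<lambda>_. 0) (\<lambda>_. 1)"
    by (auto simp: realizes_def children_def parent_function_def)
  then show ?case by blast
next
  case attach
  then show ?case using realizes_attach assms(2) by blast
qed

text \<open>With label sum \<open>k\<close> the root equation holds as well, so \<open>x\<close> is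
  a positive eigenfunction. Non-root vertices have at most \<open>r - 1\<close> children and one
  parent, so the root attains the maximum degree.\<close>

lemma tree_of_branch:
  assumes "branch (r - 1) k r (real k)" and "k > 0" "r \<ge> 1"
  shows "\<exists>T :: nat pair_pre_digraph.
    undirected_tree T \<and> graph_spectral_radius T = sqrt k \<and> max_degree T = r"
proof -
  obtain N p x where *: "realizes (r - 1) k r k N p x"
    using branch_realized[OF assms(1,2)] by blast
  then interpret parent_function N p by (simp add: realizes_def)
  have "x 0 > 0" using * N by (simp add: realizes_def)
  have root: "(\<Sum>j\<in>children N p 0. x j) = sqrt k * x 0"
  proof -
    have "sqrt k * (\<Sum>j\<in>children N p 0. x j) = sqrt k * (sqrt k * x 0)"
      using * by (simp add: realizes_def flip: mult.assoc)
    then show ?thesis using assms(2) by simp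
  qed
  have "graph_spectral_radius G = sqrt k"
  proof (rule graph_spectral_radius_eqI[where h = x])
    show "(\<Sum>u\<in>nbrs G v. x u) = sqrt k * x v" if "v \<in> pverts G" for v
      using that * root
      by (cases "v = 0") (auto simp: nbrs_root nbrs_nonroot finite_children parent_notin_children
          pverts_parent_graph realizes_def)
  qed (use * N in \<open>auto simp: pverts_parent_graph realizes_def\<close>)
  moreover have "max_degree G = r"
    unfolding max_degree_def out_degree_with_proj
  proof (rule Max_eqI)
    have "card (nbrs G 0) = r" using * by (simp add: nbrs_root realizes_def)
    then show "r \<in> (\<lambda>v. card (nbrs G v)) ` pverts G"
      using N by (auto simp: pverts_parent_graph intro!: image_eqI[of _ _ 0])
    fix d assume "d \<in> (\<lambda>v. card (nbrs G v)) ` pverts G"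
    then obtain i where i: "i < N" "d = card (nbrs G i)" by (auto simp: pverts_parent_graph)
    show "d \<le> r"
    proof (cases "i = 0")
      case False
      then have "card (children N p i) \<le> r - 1" "d = Suc (card (children N p i))"
        using i * by (auto simp: nbrs_nonroot finite_children parent_notin_children realizes_def)
      then show ?thesis using assms(3) by simp
    qed (use i \<open>card (nbrs G 0) = r\<close> in simp)
  qed (simp add: pverts_parent_graph)
  ultimately show ?thesis using undirected_tree_parent_graph by blast
qed

theorem theorem1p5:
  fixes k r :: nat
  assumes "k \<ge> 2" and "r \<ge> 2"
  shows "(\<exists>T :: nat pair_pre_digraph.
            undirected_tree T \<and> graph_spectral_radius T = sqrt (real k) \<and> max_degree T = r)
         \<longleftrightarrow> real k / 4 + 1 < real r \<and> r \<le> k"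
proof
  assume "real k / 4 + 1 < real r \<and> r \<le> k"
  then show "\<exists>T :: nat pair_pre_digraph.
      undirected_tree T \<and> graph_spectral_radius T = sqrt (real k) \<and> max_degree T = r"
    using assms by (intro tree_of_branch branch_exists) auto
next
  assume "\<exists>T :: nat pair_pre_digraph.
      undirected_tree T \<and> graph_spectral_radius T = sqrt (real k) \<and> max_degree T = r"
  then obtain T :: "nat pair_pre_digraph" where "graph_tree T"
    and rad: "graph_spectral_radius T = sqrt (real k)" and deg: "max_degree T = r"
    by (auto simp: undirected_tree_iff)
  then interpret graph_tree T by simp
  have ne: "pverts T \<noteq> {}"
    using conn by (auto simp: Digraph_Component.connected_def strongly_connected_def)
  have r: "r = Max ((\<lambda>v. card (nbrs T v)) ` pverts T)"
    using deg unfolding max_degree_def out_degree_with_proj by simp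
  have "r \<in> (\<lambda>v. card (nbrs T v)) ` pverts T"
    unfolding r using ne pair_finite_verts by (intro Max_in) auto
  then obtain w where "w \<in> pverts T" "r = card (nbrs T w)" by auto
  then have "sqrt r \<le> sqrt k"
    using sqrt_degree_le_spectral_radius[OF pair_graph] rad by metis
  moreover have "sqrt k < 2 * sqrt (real (r - 1))"
    unfolding rad[symmetric]
  proof (rule spectral_radius_less)
    show "card (nbrs T v) \<le> r - 1 + 1" if "v \<in> pverts T" for v
      using that assms pair_finite_verts Max_ge[of "(\<lambda>v. card (nbrs T v)) ` pverts T" "card (nbrs T v)"]
      unfolding r[symmetric] by simp
  qed (use assms in simp)
  \<comment> \<open>Squaring turns this into \<open>k < 4 * (r - 1)\<close>, the strict lower bound
    on \<open>r\<close>.\<close>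
  then have "sqrt k < sqrt (4 * real (r - 1))" by (simp add: real_sqrt_mult)
  ultimately show "real k / 4 + 1 < real r \<and> r \<le> k"
    using assms by (simp add: of_nat_diff)
qed

end
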